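(* Let $p\ge 1$ and let $0 =: k_0 < k_1 < \cdots < k_p < k_{p+1} := n$ be integers, set $n_{i+1} := k_{i+1}-k_i$ for $i=0,\dots,p$, and let $a_1,\dots,a_{p+1}\in\mathbb{R}$ be distinct. Then $$\Bigl\{ X\in \mathsf{S}^2(\mathbb{R}^n) : \prod_{j=0}^{p} (X - a_{j+1} I_n) = 0,\ \operatorname{tr}(X^i) = \sum_{j=0}^{p} n_{j+1} a_{j+1}^i \text{ for } i=1,\dots,p \Bigr\} = \bigl\{ Q\operatorname{diag}(a_1 I_{n_1}, a_2 I_{n_2},\dots,a_{p+1}I_{n_{p+1}})Q^{\mathsf T} : Q\in\operatorname{SO}_n(\mathbb{R})\bigr\}.$$
   Context: $\mathsf{S}^2(\mathbb{R}^n)$ is the space of real symmetric $n\times n$ matrices; $\operatorname{diag}(\cdots)$ denotes a block diagonal matrix; $I_m$ is the $m\times m$ identity matrix. *)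

theory Defs
  imports Complex_Main "Jordan_Normal_Form.Determinant"
begin

definition symmetric_mats :: "nat \<Rightarrow> real mat set" where
  "symmetric_mats n = {X \<in> carrier_mat n n. transpose_mat X = X}"

definition mat_trace :: "real mat \<Rightarrow> real" where
  "mat_trace A = (\<Sum>i<dim_row A. A $$ (i, i))"

(* The dimension is explicit because the empty product depends on it.
   Factors are multiplied in list order. *)
definition mat_prod_list :: "nat \<Rightarrow> real mat list \<Rightarrow> real mat" where
  "mat_prod_list n As = foldr (*) As (1\<^sub>m n)"

(* The predicate orthogonal_mat of Jordan_Normal_Form.Matrix is not used here:
   it does not require the columns to have norm 1. *)
definition special_orthogonal :: "nat \<Rightarrow> real mat set" where
  "special_orthogonal n = {Q \<in> carrier_mat n n. transpose_mat Q * Q = 1\<^sub>m n \<and> det Q = 1}"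

end

theory Submission
  imports Defs
begin

text \<open>
  The trace conditions are spectral information in disguise. If a symmetric \<open>X\<close> is annihilated by
  \<open>(X - c\<^sub>1 I) \<cdots> (X - c\<^sub>r I)\<close>, then it has an orthonormal eigenbasis, and its eigenvalues lie
  among the \<open>c\<^sub>j\<close> (\<open>annihilated_symmetric_diagonalizable\<close>). The existence of an eigenvector
  needs neither complex numbers nor compactness: the determinant of the product vanishes, hence so
  does the determinant of a factor. A Householder reflection carries the first basis vector to a
  unit eigenvector and splits off a one by one block; the remaining block is again symmetric and
  annihilated by the same product, so induction on the size applies.

  What is left to determine is how often each \<open>c\<^sub>j\<close> occurs. The trace of \<open>X\<^sup>i\<close> is the \<open>i\<close>-th
  power sum of the eigenvalues, and the zeroth power sum, the number of eigenvalues, is \<open>n\<close>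
  for free. With \<open>r\<close> distinct candidates, the power sums for \<open>i < r\<close> give the sum over the
  eigenvalues of any polynomial of degree below \<open>r\<close>; the polynomial that vanishes at all
  candidates but one isolates the multiplicity of that one (\<open>mset_eq_of_power_sums\<close>).

  So the eigenvalues of \<open>X\<close> are the prescribed ones up to order. Permuting the columns of the
  orthogonal matrix puts them into the prescribed order (\<open>orthogonal_reorder\<close>), and changing
  the sign of one column if needed makes the determinant 1, without changing the conjugate of a diagonal
  matrix (\<open>orthogonal_to_special\<close>). The converse inclusion holds because symmetry, traces of
  powers and the annihilating product are all compatible with orthogonal conjugation, and so can be
  read off from the diagonal matrix.
\<close>

definition orthogonal_mats :: "nat \<Rightarrow> real mat set" where
  "orthogonal_mats n = {Q \<in> carrier_mat n n. transpose_mat Q * Q = 1\<^sub>m n}"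

text \<open>
  Diagonal matrices are indexed by lists because the reordering argument compares multisets of
  entries, and because block diagonal matrices arise from concatenation.
\<close>

definition list_diag_mat :: "real list \<Rightarrow> real mat" where
  "list_diag_mat xs = mat_diag (length xs) (\<lambda>i. xs ! i)"

definition annihilator_prod :: "nat \<Rightarrow> real mat \<Rightarrow> real list \<Rightarrow> real mat" where
  "annihilator_prod n X cs = mat_prod_list n (map (\<lambda>c. X - c \<cdot>\<^sub>m 1\<^sub>m n) cs)"

section \<open>Orthogonal matrices and invariants of conjugation\<close>

lemma orthogonal_matsD:
  assumes "Q \<in> orthogonal_mats n"
  shows "Q \<in> carrier_mat n n" "transpose_mat Q \<in> carrier_mat n n"
    "transpose_mat Q * Q = 1\<^sub>m n" "Q * transpose_mat Q = 1\<^sub>m n"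
proof -
  show Q: "Q \<in> carrier_mat n n" and Qt: "transpose_mat Q \<in> carrier_mat n n"
    and QQ: "transpose_mat Q * Q = 1\<^sub>m n"
    using assms by (auto simp: orthogonal_mats_def)
  show "Q * transpose_mat Q = 1\<^sub>m n"
    by (rule mat_mult_left_right_inverse[OF Qt Q QQ])
qed

lemma orthogonal_mats_mult:
  assumes "Q \<in> orthogonal_mats n" "R \<in> orthogonal_mats n"
  shows "Q * R \<in> orthogonal_mats n"
proof -
  note Q = orthogonal_matsD[OF assms(1)] and R = orthogonal_matsD[OF assms(2)]
  have "transpose_mat (Q * R) * (Q * R) = transpose_mat R * (transpose_mat Q * Q) * R"
    using Q(1,2) R(1,2) by (simp add: transpose_mult[of _ n n _ n] assoc_mult_mat[of _ n n _ n _ n])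
  then show ?thesis using Q R by (simp add: orthogonal_mats_def)
qed

lemma orthogonal_mats_transpose:
  "Q \<in> orthogonal_mats n \<Longrightarrow> transpose_mat Q \<in> orthogonal_mats n"
  by (frule orthogonal_matsD(4)) (auto simp: orthogonal_mats_def)

lemma orthogonal_conj_similar:
  assumes "Q \<in> orthogonal_mats n" "D \<in> carrier_mat n n"
  shows "similar_mat_wit (Q * D * transpose_mat Q) D Q (transpose_mat Q)"
  using orthogonal_matsD[OF assms(1)] assms(2) by (intro similar_mat_witI[of _ _ n]) auto

lemma mat_trace_mult_commute:
  assumes "A \<in> carrier_mat n n" "B \<in> carrier_mat n n"
  shows "mat_trace (A * B) = mat_trace (B * A)"
proof -
  have "mat_trace (A * B) = (\<Sum>i<n. \<Sum>j<n. A $$ (i, j) * B $$ (j, i))"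
    using assms by (auto simp: mat_trace_def scalar_prod_def atLeast0LessThan intro!: sum.cong)
  also have "\<dots> = (\<Sum>j<n. \<Sum>i<n. B $$ (j, i) * A $$ (i, j))"
    by (subst sum.swap) (simp add: mult.commute)
  also have "\<dots> = mat_trace (B * A)"
    using assms by (auto simp: mat_trace_def scalar_prod_def atLeast0LessThan intro!: sum.cong)
  finally show ?thesis .
qed

lemma mat_trace_similar:
  assumes "similar_mat_wit A B P Q"
  shows "mat_trace A = mat_trace B"
proof -
  obtain n where n: "n = dim_row A" by simp
  note D = similar_mat_witD[OF n assms]
  have "mat_trace A = mat_trace (Q * (P * B))"
    using mat_trace_mult_commute[of "P * B" n Q] D(5-7) by (subst D(3)) simp
  also have "Q * (P * B) = B"
    using assoc_mult_mat[OF D(7,6,5)] D(2,5) by simp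
  finally show ?thesis .
qed

lemma annihilator_prod_simps [simp]:
  "annihilator_prod n X [] = 1\<^sub>m n"
  "annihilator_prod n X (c # cs) = (X - c \<cdot>\<^sub>m 1\<^sub>m n) * annihilator_prod n X cs"
  by (simp_all add: annihilator_prod_def mat_prod_list_def)

lemma shifted_mat_carrier [simp]:
  fixes X :: "real mat"
  shows "X \<in> carrier_mat n n \<Longrightarrow> X - c \<cdot>\<^sub>m 1\<^sub>m n \<in> carrier_mat n n"
  by auto

lemma annihilator_prod_carrier [simp]:
  "X \<in> carrier_mat n n \<Longrightarrow> annihilator_prod n X cs \<in> carrier_mat n n"
  by (induction cs) (auto intro!: mult_carrier_mat[of _ n n])

text \<open>
  Scalar matrices are fixed by orthogonal conjugation, so each factor is the conjugate of the
  corresponding factor for \<open>D\<close>, and the inner pairs \<open>Q\<^sup>T Q\<close> cancel. The lemma is used in both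
  directions: to transport annihilation to a block form, and back from a diagonal matrix.
\<close>

lemma annihilator_prod_conj:
  assumes Q: "Q \<in> orthogonal_mats n" and D: "D \<in> carrier_mat n n"
  shows "annihilator_prod n (Q * D * transpose_mat Q) cs
         = Q * annihilator_prod n D cs * transpose_mat Q"
proof (induction cs)
  case Nil
  then show ?case using orthogonal_matsD[OF Q] by simp
next
  case (Cons c cs)
  note q = orthogonal_matsD[OF Q]
  let ?R = "annihilator_prod n D cs"
  have R: "?R \<in> carrier_mat n n" using D by simp
  have E: "D - c \<cdot>\<^sub>m 1\<^sub>m n \<in> carrier_mat n n" using D by auto
  have "Q * (D - c \<cdot>\<^sub>m 1\<^sub>m n) * transpose_mat Q
        = Q * D * transpose_mat Q - Q * (c \<cdot>\<^sub>m 1\<^sub>m n) * transpose_mat Q"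
    using q D by (simp add: mult_minus_distrib_mat[of _ n n _ n] minus_mult_distrib_mat[of _ n n _ _ n])
  also have "Q * (c \<cdot>\<^sub>m 1\<^sub>m n) * transpose_mat Q = c \<cdot>\<^sub>m 1\<^sub>m n"
    using q by (simp add: mult_smult_distrib[of _ n n _ n] mult_smult_assoc_mat[of _ n n _ n])
  finally have shift: "Q * D * transpose_mat Q - c \<cdot>\<^sub>m 1\<^sub>m n = Q * (D - c \<cdot>\<^sub>m 1\<^sub>m n) * transpose_mat Q" ..
  have "annihilator_prod n (Q * D * transpose_mat Q) (c # cs)
        = (Q * (D - c \<cdot>\<^sub>m 1\<^sub>m n) * transpose_mat Q) * (Q * ?R * transpose_mat Q)"
    by (simp add: Cons.IH shift)
  also have "\<dots> = Q * ((D - c \<cdot>\<^sub>m 1\<^sub>m n) * (transpose_mat Q * Q) * ?R) * transpose_mat Q"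
    using q(1,2) E R by (simp add: assoc_mult_mat[of _ n n _ n _ n])
  also have "(D - c \<cdot>\<^sub>m 1\<^sub>m n) * (transpose_mat Q * Q) * ?R = annihilator_prod n D (c # cs)"
    using q(3) E by simp
  finally show ?case .
qed

lemma list_diag_mat_carrier: "length xs = n \<Longrightarrow> list_diag_mat xs \<in> carrier_mat n n"
  by (auto simp: list_diag_mat_def)

lemma transpose_mat_diag [simp]: "transpose_mat (mat_diag n f) = mat_diag n f"
  by (rule eq_matI) (auto simp: mat_diag_def)

lemma mat_diag_pow: "mat_diag n (f :: nat \<Rightarrow> real) ^\<^sub>m i = mat_diag n (\<lambda>j. f j ^ i)"
proof (induction i)
  case 0
  show ?case by (simp add: mat_diag_def)
next
  case (Suc i)
  then show ?case by (simp add: mult.commute)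
qed

lemma mat_trace_list_diag_mat_pow:
  "mat_trace (list_diag_mat xs ^\<^sub>m i) = sum_list (map (\<lambda>x. x ^ i) xs)"
  by (simp add: list_diag_mat_def mat_diag_pow)
     (simp add: mat_trace_def mat_diag_def sum_list_sum_nth atLeast0LessThan)

lemma annihilator_prod_mat_diag:
  "annihilator_prod n (mat_diag n f) cs = mat_diag n (\<lambda>i. \<Prod>c\<leftarrow>cs. f i - c)"
proof (induction cs)
  case (Cons c cs)
  have "mat_diag n f - c \<cdot>\<^sub>m 1\<^sub>m n = mat_diag n (\<lambda>i. f i - c)"
    by (rule eq_matI) (auto simp: mat_diag_def)
  then show ?case by (simp add: Cons.IH)
qed simp

lemma annihilator_prod_list_diag_mat_eq_0:
  assumes "set xs \<subseteq> set cs" "length xs = n"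
  shows "annihilator_prod n (list_diag_mat xs) cs = 0\<^sub>m n n"
proof -
  have "(\<Prod>c\<leftarrow>cs. xs ! i - c) = 0" if "i < n" for i
    using assms that by (auto simp: prod_list_zero_iff subset_iff)
  then have "mat_diag n (\<lambda>i. \<Prod>c\<leftarrow>cs. xs ! i - c) = 0\<^sub>m n n"
    by (intro eq_matI) (auto simp: mat_diag_def)
  then show ?thesis using assms(2) by (simp add: list_diag_mat_def annihilator_prod_mat_diag)
qed

section \<open>Orthogonal diagonalization of an annihilated symmetric matrix\<close>

text \<open>
  The witness is the Householder reflection \<open>I - (2 / (w \<bullet> w)) w w\<^sup>T\<close> with \<open>w = v - e\<^sub>0\<close>, which
  exchanges the two unit vectors \<open>e\<^sub>0\<close> and \<open>v\<close>. It completes \<open>v\<close> to an orthonormal basis by an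
  explicit formula, in place of a Gram-Schmidt process.
\<close>

lemma householder:
  assumes v: "v \<in> carrier_vec (Suc n)" and unit: "v \<bullet> v = (1 :: real)"
  shows "\<exists>W \<in> orthogonal_mats (Suc n). col W 0 = v"
proof -
  define w where "w = (\<lambda>i. v $ i - (if i = 0 then 1 else 0))"
  define s where "s = (\<Sum>i<Suc n. w i * w i)"
  define c where "c = 2 / s"
  define W where "W = mat (Suc n) (Suc n) (\<lambda>(i, j). (if i = j then 1 else 0) - c * w i * w j)"
  have W: "W \<in> carrier_mat (Suc n) (Suc n)" by (simp add: W_def)
  (* At s = 0 division by zero gives c = 0, so this identity holds there as well. *)
  have cs: "c * c * s = 2 * c" by (simp add: c_def)
  have "(\<Sum>k<Suc n. ((if k = i then 1 else 0) - c * w k * w i) * ((if k = j then 1 else 0) - c * w k * w j))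
        = (if i = j then 1 else 0)" if "i < Suc n" "j < Suc n" for i j
  proof -
    have "(\<Sum>k<Suc n. ((if k = i then 1 else 0) - c * w k * w i) * ((if k = j then 1 else 0) - c * w k * w j))
        = (\<Sum>k<Suc n. (if k = i then (if i = j then 1 else 0) - c * w i * w j else 0)
            - (if k = j then c * w i * w j else 0) + c * c * w i * w j * (w k * w k))"
      by (intro sum.cong) (auto simp: algebra_simps)
    also have "\<dots> = (if i = j then 1 else 0) - c * w i * w j - c * w i * w j + c * c * w i * w j * s"
      using that by (simp only: sum.distrib sum_subtractf sum_distrib_left[symmetric] s_def) simp
    also have "\<dots> = (if i = j then 1 else 0) + (c * c * s - 2 * c) * (w i * w j)"
      by (simp add: algebra_simps)
    finally show ?thesis by (simp add: cs)
  qed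
  then have "transpose_mat W * W = 1\<^sub>m (Suc n)"
    by (intro eq_matI) (auto simp: W_def scalar_prod_def atLeast0LessThan)
  then have orth: "W \<in> orthogonal_mats (Suc n)" using W by (simp add: orthogonal_mats_def)
  have vv: "(\<Sum>i<Suc n. v $ i * v $ i) = 1"
    using unit v by (simp add: scalar_prod_def atLeast0LessThan)
  (* Both v and the first basis vector are unit vectors, so s = 2 - 2 * v $ 0. *)
  have s: "s = - 2 * w 0"
  proof -
    have "s = (\<Sum>i<Suc n. v $ i * v $ i + (if i = 0 then 1 - 2 * v $ 0 else 0))"
      unfolding s_def w_def by (intro sum.cong) (auto simp: algebra_simps)
    also have "\<dots> = 1 + (1 - 2 * v $ 0)" by (simp only: sum.distrib vv) simp
    finally show ?thesis by (simp add: w_def)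
  qed
  have "c * w i * w 0 = - w i" if "i < Suc n" for i
  proof (cases "s = 0")
    case True
    then have "\<forall>i \<in> {..<Suc n}. w i * w i = 0"
      unfolding s_def by (subst (asm) sum_nonneg_eq_0_iff) auto
    with that show ?thesis by auto
  next
    case False
    with s show ?thesis by (simp add: c_def field_simps)
  qed
  then have "col W 0 = v"
    using v by (intro eq_vecI) (auto simp: W_def w_def)
  with orth show ?thesis by blast
qed

lemma mult_block_diag:
  fixes A B C D :: "real mat"
  assumes "A \<in> carrier_mat m m" "C \<in> carrier_mat m m" "B \<in> carrier_mat n n" "D \<in> carrier_mat n n"
  shows "four_block_mat A (0\<^sub>m m n) (0\<^sub>m n m) B * four_block_mat C (0\<^sub>m m n) (0\<^sub>m n m) D
         = four_block_mat (A * C) (0\<^sub>m m n) (0\<^sub>m n m) (B * D)"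
proof -
  have "A * C \<in> carrier_mat m m" "B * D \<in> carrier_mat n n" using assms by auto
  then show ?thesis
    using assms by (subst mult_four_block_mat[of _ m m _ n _ n _ _ m _ n]) auto
qed

lemma annihilator_prod_four_block:
  assumes "A \<in> carrier_mat m m" "B \<in> carrier_mat n n"
  shows "annihilator_prod (m + n) (four_block_mat A (0\<^sub>m m n) (0\<^sub>m n m) B) cs
         = four_block_mat (annihilator_prod m A cs) (0\<^sub>m m n) (0\<^sub>m n m) (annihilator_prod n B cs)"
proof (induction cs)
  case (Cons c cs)
  have "four_block_mat A (0\<^sub>m m n) (0\<^sub>m n m) B - c \<cdot>\<^sub>m 1\<^sub>m (m + n)
        = four_block_mat (A - c \<cdot>\<^sub>m 1\<^sub>m m) (0\<^sub>m m n) (0\<^sub>m n m) (B - c \<cdot>\<^sub>m 1\<^sub>m n)"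
    using assms by (intro eq_matI) auto
  then show ?case
    using assms by (simp add: Cons.IH mult_block_diag)
qed simp

text \<open>
  The determinant of the zero matrix of positive size is 0, and it is the product of the
  determinants of the factors; so one factor is singular, and a unit vector in its kernel is the
  eigenvector sought.
\<close>

lemma annihilated_unit_eigenvector:
  assumes X: "X \<in> carrier_mat n n" and n: "n > 0"
    and ann: "annihilator_prod n X cs = 0\<^sub>m n n"
  obtains c v where "c \<in> set cs" "v \<in> carrier_vec n" "v \<bullet> v = 1" "X *\<^sub>v v = c \<cdot>\<^sub>v v"
proof -
  have "det (annihilator_prod n X cs) = (\<Prod>c\<leftarrow>cs. det (X - c \<cdot>\<^sub>m 1\<^sub>m n))"
    using X by (induction cs) (simp_all add: det_mult[of _ n])
  with ann n have "(\<Prod>c\<leftarrow>cs. det (X - c \<cdot>\<^sub>m 1\<^sub>m n)) = 0" by simp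
  then obtain c where c: "c \<in> set cs" "det (X - c \<cdot>\<^sub>m 1\<^sub>m n) = 0"
    by (auto simp: prod_list_zero_iff)
  then obtain u where u: "u \<in> carrier_vec n" "u \<noteq> 0\<^sub>v n" and ker: "(X - c \<cdot>\<^sub>m 1\<^sub>m n) *\<^sub>v u = 0\<^sub>v n"
    using det_0_iff_vec_prod_zero[OF shifted_mat_carrier[OF X]] by blast
  have Xu: "X *\<^sub>v u = c \<cdot>\<^sub>v u"
  proof (rule eq_vecI)
    fix i assume "i < dim_vec (c \<cdot>\<^sub>v u)"
    then have i: "i < n" using u by simp
    have "((X - c \<cdot>\<^sub>m 1\<^sub>m n) *\<^sub>v u) $ i = 0" using ker i by simp
    also have "((X - c \<cdot>\<^sub>m 1\<^sub>m n) *\<^sub>v u) $ i = (\<Sum>j<n. X $$ (i, j) * u $ j - (if j = i then c * u $ i else 0))"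
      using X u(1) i by (auto simp: scalar_prod_def atLeast0LessThan left_diff_distrib intro!: sum.cong)
    also have "\<dots> = (X *\<^sub>v u) $ i - c * u $ i"
      using X u(1) i by (simp add: sum_subtractf scalar_prod_def atLeast0LessThan)
    finally show "(X *\<^sub>v u) $ i = (c \<cdot>\<^sub>v u) $ i" using i u(1) by simp
  qed (use X u(1) in auto)
  obtain i where i: "i < n" "u $ i \<noteq> 0"
    using u by (metis carrier_vecD eq_vecI index_zero_vec)
  have "0 < u $ i * u $ i" using i(2) by (auto simp: zero_less_mult_iff)
  also have "\<dots> \<le> (\<Sum>j<n. u $ j * u $ j)"
    using i(1) by (intro member_le_sum) auto
  also have "\<dots> = u \<bullet> u" using u(1) by (simp add: scalar_prod_def atLeast0LessThan)
  finally have pos: "u \<bullet> u > 0" .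
  let ?t = "1 / sqrt (u \<bullet> u)"
  have "(?t \<cdot>\<^sub>v u) \<bullet> (?t \<cdot>\<^sub>v u) = 1"
    using u pos by (simp add: real_sqrt_mult_self)
  moreover have "X *\<^sub>v (?t \<cdot>\<^sub>v u) = c \<cdot>\<^sub>v (?t \<cdot>\<^sub>v u)"
    using X u by (simp add: mult_mat_vec Xu smult_smult_assoc mult.commute)
  ultimately show thesis using that[of c "?t \<cdot>\<^sub>v u"] c(1) u(1) by simp
qed

lemma list_diag_mat_Cons:
  "list_diag_mat (x # xs) = four_block_mat (x \<cdot>\<^sub>m 1\<^sub>m 1) (0\<^sub>m 1 (length xs)) (0\<^sub>m (length xs) 1) (list_diag_mat xs)"
  by (rule eq_matI) (auto simp: list_diag_mat_def mat_diag_def nth_Cons')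

text \<open>
  This is the spectral theorem for symmetric matrices that satisfy a given split polynomial
  equation. The factorization of the polynomial supplies the eigenvector on which deflation
  starts; symmetry makes the deflated matrix block diagonal, not merely block triangular.
\<close>

lemma annihilated_symmetric_diagonalizable:
  assumes "X \<in> symmetric_mats n" "annihilator_prod n X cs = 0\<^sub>m n n"
  shows "\<exists>Q \<in> orthogonal_mats n. \<exists>xs. length xs = n \<and> set xs \<subseteq> set cs \<and>
           X = Q * list_diag_mat xs * transpose_mat Q"
  using assms
proof (induction n arbitrary: X)
  case 0
  then show ?case
    by (intro bexI[of _ "1\<^sub>m 0"] exI[of _ "[]"]) (auto simp: orthogonal_mats_def symmetric_mats_def)
next
  case (Suc n)
  have X: "X \<in> carrier_mat (Suc n) (Suc n)" and Xt: "transpose_mat X = X"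
    using Suc.prems(1) by (auto simp: symmetric_mats_def)
  obtain c v where c: "c \<in> set cs" and v: "v \<in> carrier_vec (Suc n)" "v \<bullet> v = 1"
    and Xv: "X *\<^sub>v v = c \<cdot>\<^sub>v v"
    by (rule annihilated_unit_eigenvector[OF X _ Suc.prems(2)]) auto
  obtain W where W: "W \<in> orthogonal_mats (Suc n)" and col: "col W 0 = v"
    using householder[OF v] by blast
  note w = orthogonal_matsD[OF W]
  define Y where "Y = transpose_mat W * X * W"
  have Y: "Y \<in> carrier_mat (Suc n) (Suc n)" using w X by (auto simp: Y_def)
  have Yt: "transpose_mat Y = Y"
    using w X Xt by (simp add: Y_def transpose_mult[of _ "Suc n" "Suc n" _ "Suc n"]
      assoc_mult_mat[of _ "Suc n" "Suc n" _ "Suc n" _ "Suc n"])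
  have XY: "X = W * Y * transpose_mat W"
  proof -
    have "W * Y * transpose_mat W = (W * transpose_mat W) * X * (W * transpose_mat W)"
      using w(1,2) X by (simp add: Y_def assoc_mult_mat[of _ "Suc n" "Suc n" _ "Suc n" _ "Suc n"])
    then show ?thesis using w X by simp
  qed
  have Ycol: "Y $$ (i, 0) = (if i = 0 then c else 0)" if "i < Suc n" for i
  proof -
    have "col Y 0 = (transpose_mat W * X) *\<^sub>v col W 0"
      unfolding Y_def by (rule col_mult2) (use w X in auto)
    also have "\<dots> = transpose_mat W *\<^sub>v (X *\<^sub>v col W 0)"
      by (rule assoc_mult_mat_vec) (use w X v col in auto)
    also have "\<dots> = c \<cdot>\<^sub>v (transpose_mat W *\<^sub>v col W 0)"
      using w v by (simp add: col Xv mult_mat_vec)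
    also have "transpose_mat W *\<^sub>v col W 0 = col (transpose_mat W * W) 0"
      by (rule col_mult2[symmetric]) (use w in auto)
    also have "transpose_mat W * W = 1\<^sub>m (Suc n)" by (rule w(3))
    finally have "col Y 0 $ i = (c \<cdot>\<^sub>v col (1\<^sub>m (Suc n)) 0) $ i" by simp
    with that Y show ?thesis by auto
  qed
  have Yrow: "Y $$ (0, i) = (if i = 0 then c else 0)" if "i < Suc n" for i
    using Ycol[OF that] that Y arg_cong[OF Yt, of "\<lambda>A. A $$ (0, i)"] by simp
  (* The block that is complementary to the eigenvector inherits symmetry and annihilation. *)
  define Z where "Z = mat n n (\<lambda>(i, j). Y $$ (Suc i, Suc j))"
  have Z: "Z \<in> carrier_mat n n" by (simp add: Z_def)
  have YZ: "Y = four_block_mat (c \<cdot>\<^sub>m 1\<^sub>m 1) (0\<^sub>m 1 n) (0\<^sub>m n 1) Z"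
    using Y by (intro eq_matI) (auto simp: Z_def Ycol Yrow)
  have "Z $$ (j, i) = Z $$ (i, j)" if "i < n" "j < n" for i j
    using that Y arg_cong[OF Yt, of "\<lambda>A. A $$ (Suc i, Suc j)"] by (simp add: Z_def)
  then have Zsym: "Z \<in> symmetric_mats n"
    using Z by (auto simp: symmetric_mats_def intro!: eq_matI)
  have "annihilator_prod (Suc n) Y cs = 0\<^sub>m (Suc n) (Suc n)"
    using annihilator_prod_conj[OF orthogonal_mats_transpose[OF W] X, of cs] w Suc.prems(2)
    by (simp add: Y_def)
  then have blocks: "four_block_mat (annihilator_prod 1 (c \<cdot>\<^sub>m 1\<^sub>m 1) cs) (0\<^sub>m 1 n) (0\<^sub>m n 1)
               (annihilator_prod n Z cs) = 0\<^sub>m (Suc n) (Suc n)" (is "?F = _")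
    using annihilator_prod_four_block[of "c \<cdot>\<^sub>m 1\<^sub>m 1" 1 Z n cs] Z YZ by simp
  have PZ: "annihilator_prod n Z cs \<in> carrier_mat n n"
    and Pc: "annihilator_prod 1 (c \<cdot>\<^sub>m 1\<^sub>m 1) cs \<in> carrier_mat 1 1" using Z by auto
  have "annihilator_prod n Z cs $$ (i, j) = 0" if "i < n" "j < n" for i j
    using that carrier_matD[OF PZ] carrier_matD[OF Pc]
      arg_cong[OF blocks, of "\<lambda>A. A $$ (Suc i, Suc j)"] by simp
  then have "annihilator_prod n Z cs = 0\<^sub>m n n" using PZ by (intro eq_matI) auto
  from Suc.IH[OF Zsym this] obtain R xs where R: "R \<in> orthogonal_mats n"
    and xs: "length xs = n" "set xs \<subseteq> set cs" and ZR: "Z = R * list_diag_mat xs * transpose_mat R"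
    by blast
  note r = orthogonal_matsD[OF R]
  define V where "V = four_block_mat (1\<^sub>m 1) (0\<^sub>m 1 n) (0\<^sub>m n 1) R"
  have Vc: "V \<in> carrier_mat (Suc n) (Suc n)" using r by (auto simp: V_def)
  have Vt: "transpose_mat V = four_block_mat (1\<^sub>m 1) (0\<^sub>m 1 n) (0\<^sub>m n 1) (transpose_mat R)"
    using r by (simp add: V_def transpose_four_block_mat[of _ 1 1 _ n _ n])
  have "transpose_mat V * V = 1\<^sub>m (1 + n)"
    unfolding Vt unfolding V_def using r by (simp add: mult_block_diag del: One_nat_def)
  then have V: "V \<in> orthogonal_mats (Suc n)" using Vc by (simp add: orthogonal_mats_def)
  have D: "list_diag_mat xs \<in> carrier_mat n n" using xs by (simp add: list_diag_mat_carrier)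
  have D': "list_diag_mat (c # xs) \<in> carrier_mat (Suc n) (Suc n)"
    using xs by (simp add: list_diag_mat_carrier)
  have "V * list_diag_mat (c # xs) = four_block_mat (c \<cdot>\<^sub>m 1\<^sub>m 1) (0\<^sub>m 1 n) (0\<^sub>m n 1) (R * list_diag_mat xs)"
    unfolding V_def list_diag_mat_Cons xs(1) using r D by (simp add: mult_block_diag del: One_nat_def)
  then have VY: "Y = V * list_diag_mat (c # xs) * transpose_mat V"
    unfolding YZ Vt ZR using r D
    by (simp add: mult_block_diag del: One_nat_def)
  then have "X = (W * V) * list_diag_mat (c # xs) * transpose_mat (W * V)"
    using w(1,2) Vc D' by (simp add: XY VY transpose_mult[of _ "Suc n" "Suc n" _ "Suc n"]
      assoc_mult_mat[of _ "Suc n" "Suc n" _ "Suc n" _ "Suc n"])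
  then show ?case
    using orthogonal_mats_mult[OF W V] xs c by (intro bexI[of _ "W * V"] exI[of _ "c # xs"]) auto
qed

section \<open>Power sums determine multiplicities\<close>

text \<open>
  Equality of the power sums of order below \<open>card A\<close> is equality of the sums of \<open>q x\<close> for every
  polynomial \<open>q\<close> of degree below \<open>card A\<close>. For \<open>c \<in> A\<close> the (unnormalized) Lagrange polynomial
  \<open>\<Prod>b \<in> A - {c}. (x - b)\<close> has degree \<open>card A - 1\<close>, and its sum over a list with entries in \<open>A\<close> is
  its nonzero value at \<open>c\<close> times the number of occurrences of \<open>c\<close>.
\<close>

lemma mset_eq_of_power_sums:
  fixes xs ys :: "real list"
  assumes A: "finite A" "set xs \<subseteq> A" "set ys \<subseteq> A"
    and pow: "\<And>i. i < card A \<Longrightarrow> sum_list (map (\<lambda>x. x ^ i) xs) = sum_list (map (\<lambda>x. x ^ i) ys)"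
  shows "mset xs = mset ys"
proof (rule multiset_eqI)
  fix c
  show "count (mset xs) c = count (mset ys) c"
  proof (cases "c \<in> A")
    case False
    with A have "c \<notin> set xs" "c \<notin> set ys" by auto
    then show ?thesis by (simp add: count_eq_zero_iff[THEN iffD2])
  next
    case True
    define q where "q = (\<Prod>b \<in> A - {c}. [:- b, 1:])"
    have "degree q = card (A - {c})"
      unfolding q_def by (subst degree_prod_eq_sum_degree) auto
    then have deg: "degree q < card A"
      using card_Diff1_less[OF A(1) True] by simp
    have sum_poly: "sum_list (map (poly q) zs) = (\<Sum>i\<le>degree q. coeff q i * sum_list (map (\<lambda>x. x ^ i) zs))" for zs
      by (induction zs) (simp_all add: poly_altdef sum.distrib distrib_left)
    have "sum_list (map (poly q) xs) = sum_list (map (poly q) ys)"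
      unfolding sum_poly using deg pow by (intro sum.cong) auto
    moreover have "poly q x = (if x = c then poly q c else 0)" if "x \<in> A" for x
      using that A(1) by (auto simp: q_def poly_prod)
    then have "sum_list (map (poly q) zs) = real (count (mset zs) c) * poly q c" if "set zs \<subseteq> A" for zs
      using that by (induction zs) (auto simp: algebra_simps)
    moreover have "poly q c \<noteq> 0" using A(1) by (auto simp: q_def poly_prod)
    ultimately show ?thesis using A(2,3) by simp
  qed
qed

section \<open>Reordering the eigenvalues and adjusting the determinant\<close>

text \<open>
  In coordinates, \<open>Q D Q\<^sup>T\<close> is a sum over the columns of \<open>Q\<close>, each weighted by its diagonal entry;
  permuting columns and entries together only reindexes this sum.
\<close>

lemma orthogonal_reorder:
  assumes Q: "Q \<in> orthogonal_mats n" and len: "length ys = n" and ms: "mset xs = mset ys"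
  shows "\<exists>R \<in> orthogonal_mats n.
    R * list_diag_mat xs * transpose_mat R = Q * list_diag_mat ys * transpose_mat Q"
proof -
  obtain p where p: "p permutes {..<length ys}" and xs: "permute_list p ys = xs"
    using mset_eq_permutation[OF ms] .
  have p: "p permutes {..<n}" and lx: "length xs = n" using p xs len by auto
  have pn: "p i < n" if "i < n" for i using permutes_in_image[OF p, of i] that by auto
  have nth: "xs ! i = ys ! p i" if "i < n" for i
    using that p len by (simp add: permute_list_nth flip: xs)
  note q = orthogonal_matsD[OF Q]
  define R where "R = mat n n (\<lambda>(i, j). Q $$ (i, p j))"
  have R: "R \<in> carrier_mat n n" by (simp add: R_def)
  have conj: "(S * list_diag_mat zs * transpose_mat S) $$ (i, j)
      = (\<Sum>k<n. S $$ (i, k) * zs ! k * S $$ (j, k))"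
    if "S \<in> carrier_mat n n" "length zs = n" "i < n" "j < n" for S zs i j
    using that unfolding list_diag_mat_def
    by (subst mat_diag_mult_right[of _ n]) (auto simp: scalar_prod_def atLeast0LessThan)
  have "(transpose_mat R * R) $$ (i, j) = (1\<^sub>m n :: real mat) $$ (i, j)" if "i < n" "j < n" for i j
  proof -
    have "(transpose_mat R * R) $$ (i, j) = (transpose_mat Q * Q) $$ (p i, p j)"
      using that pn q(1) R by (auto simp: scalar_prod_def R_def intro!: sum.cong)
    also have "\<dots> = (if i = j then 1 else 0)"
      using that pn q(3) by (simp add: inj_eq[OF permutes_inj[OF p]])
    finally show ?thesis using that by simp
  qed
  then have "R \<in> orthogonal_mats n"
    using R by (auto simp: orthogonal_mats_def intro!: eq_matI)
  moreover have "R * list_diag_mat xs * transpose_mat R = Q * list_diag_mat ys * transpose_mat Q"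
  proof (rule eq_matI)
    fix i j assume "i < dim_row (Q * list_diag_mat ys * transpose_mat Q)"
      and "j < dim_col (Q * list_diag_mat ys * transpose_mat Q)"
    then have ij: "i < n" "j < n" using q(1) by auto
    have "(\<Sum>k<n. R $$ (i, k) * xs ! k * R $$ (j, k)) = (\<Sum>k<n. Q $$ (i, p k) * ys ! p k * Q $$ (j, p k))"
      using ij by (intro sum.cong) (auto simp: R_def nth)
    also have "\<dots> = (\<Sum>k<n. Q $$ (i, k) * ys ! k * Q $$ (j, k))"
      by (rule sum.permute[OF p, symmetric, unfolded o_def])
    finally show "(R * list_diag_mat xs * transpose_mat R) $$ (i, j)
        = (Q * list_diag_mat ys * transpose_mat Q) $$ (i, j)"
      by (simp only: conj[OF R lx ij] conj[OF q(1) len ij])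
  qed (use R q(1) in auto)
  ultimately show ?thesis by blast
qed

text \<open>
  Multiplying the first column of \<open>Q\<close> by \<open>det Q\<close>, which is 1 or \<open>-1\<close>, makes the determinant
  \<open>(det Q)\<^sup>2 = 1\<close>. The corresponding diagonal sign matrix commutes with the diagonal matrix and
  squares to the identity, so it drops out of the conjugation.
\<close>

lemma orthogonal_to_special:
  assumes Q: "Q \<in> orthogonal_mats n" and n: "n > 0" and len: "length xs = n"
  shows "\<exists>R \<in> special_orthogonal n.
    R * list_diag_mat xs * transpose_mat R = Q * list_diag_mat xs * transpose_mat Q"
proof -
  note q = orthogonal_matsD[OF Q]
  have "det (transpose_mat Q) * det Q = 1"
    using q by (simp flip: det_mult[OF q(2,1)])
  then have dd: "det Q * det Q = 1" by (simp add: det_transpose[OF q(1)])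
  define f where "f = (\<lambda>i :: nat. if i = 0 then det Q else 1)"
  define S where "S = mat_diag n f"
  have ff: "f i * f i = 1" for i using dd by (simp add: f_def)
  have S: "S \<in> carrier_mat n n" by (simp add: S_def)
  have "transpose_mat S * S = 1\<^sub>m n" by (simp add: S_def ff)
  then have So: "S \<in> orthogonal_mats n" using S by (simp add: orthogonal_mats_def)
  have "det S = (\<Prod>i = 0..<n. f i)"
    using S by (subst det_upper_triangular[OF _ S])
      (auto simp: S_def mat_diag_def prod_list_diag_prod)
  also have "\<dots> = det Q"
    using n by (simp add: f_def prod.delta)
  finally have "det (Q * S) = 1" using dd by (simp add: det_mult[OF q(1) S])
  with orthogonal_mats_mult[OF Q So] have "Q * S \<in> special_orthogonal n"
    by (simp add: orthogonal_mats_def special_orthogonal_def)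
  moreover have "(Q * S) * list_diag_mat xs * transpose_mat (Q * S) = Q * list_diag_mat xs * transpose_mat Q"
  proof -
    have D: "list_diag_mat xs \<in> carrier_mat n n" using len by (simp add: list_diag_mat_carrier)
    have "S * list_diag_mat xs * S = mat_diag n (\<lambda>i. (f i * f i) * xs ! i)"
      by (simp add: S_def list_diag_mat_def len ac_simps)
    also have "\<dots> = list_diag_mat xs" by (simp add: ff list_diag_mat_def len)
    finally have SDS: "S * list_diag_mat xs * S = list_diag_mat xs" .
    have "(Q * S) * list_diag_mat xs * transpose_mat (Q * S)
        = Q * (S * list_diag_mat xs * transpose_mat S) * transpose_mat Q"
      using q(1,2) S D by (simp add: transpose_mult[of _ n n _ n] assoc_mult_mat[of _ n n _ n _ n])
    also have "transpose_mat S = S" by (simp add: S_def)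
    finally show ?thesis by (simp add: SDS)
  qed
  ultimately show ?thesis by blast
qed

section \<open>Prescribed traces and orbits of the special orthogonal group\<close>

lemma list_diag_mat_replicate_append:
  "list_diag_mat (replicate k x @ xs)
   = four_block_mat (x \<cdot>\<^sub>m 1\<^sub>m k) (0\<^sub>m k (length xs)) (0\<^sub>m (length xs) k) (list_diag_mat xs)"
  by (rule eq_matI) (auto simp: list_diag_mat_def mat_diag_def nth_append)

lemma diag_block_mat_scalar_blocks:
  "diag_block_mat (map (\<lambda>j. a j \<cdot>\<^sub>m 1\<^sub>m (m j)) js)
   = list_diag_mat (concat (map (\<lambda>j. replicate (m j) (a j)) js))"
proof (induction js)
  case Nil
  show ?case by (intro eq_matI) (auto simp: list_diag_mat_def mat_diag_def)
next
  case (Cons j js)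
  let ?xs = "concat (map (\<lambda>j. replicate (m j) (a j)) js)"
  have "dim_row (list_diag_mat ?xs) = length ?xs" "dim_col (list_diag_mat ?xs) = length ?xs"
    using list_diag_mat_carrier[OF refl, of ?xs] by auto
  with Cons show ?case by (simp add: list_diag_mat_replicate_append Let_def)
qed

text \<open>
  For a prescribed list \<open>ys\<close> of eigenvalues taken from the roots \<open>cs\<close>, the power sum of order 0
  is the size of the matrix, so traces of the powers up to one less than the number of distinct
  roots determine the multiplicities.
\<close>

theorem annihilated_isospectral_eq_special_orthogonal_orbit:
  assumes n: "n > 0" and ys: "length ys = n" "set ys \<subseteq> set cs"
  shows "{X \<in> symmetric_mats n. annihilator_prod n X cs = 0\<^sub>m n n \<and>
            (\<forall>i \<in> {1..<card (set cs)}. mat_trace (X ^\<^sub>m i) = sum_list (map (\<lambda>y. y ^ i) ys))}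
         = {Q * list_diag_mat ys * transpose_mat Q | Q. Q \<in> special_orthogonal n}"
    (is "?L = ?R")
proof (intro subset_antisym subsetI)
  fix X assume "X \<in> ?L"
  then have X: "X \<in> symmetric_mats n" "annihilator_prod n X cs = 0\<^sub>m n n"
    and tr: "\<And>i. i \<in> {1..<card (set cs)} \<Longrightarrow> mat_trace (X ^\<^sub>m i) = sum_list (map (\<lambda>y. y ^ i) ys)"
    by auto
  obtain Q xs where Q: "Q \<in> orthogonal_mats n" and xs: "length xs = n" "set xs \<subseteq> set cs"
    and XQ: "X = Q * list_diag_mat xs * transpose_mat Q"
    using annihilated_symmetric_diagonalizable[OF X] by blast
  have sim: "similar_mat_wit X (list_diag_mat xs) Q (transpose_mat Q)"
    unfolding XQ using xs by (intro orthogonal_conj_similar[OF Q] list_diag_mat_carrier)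
  have "mset ys = mset xs"
  proof (rule mset_eq_of_power_sums[OF _ ys(2) xs(2)])
    fix i assume i: "i < card (set cs)"
    show "sum_list (map (\<lambda>y. y ^ i) ys) = sum_list (map (\<lambda>x. x ^ i) xs)"
    proof (cases "i = 0")
      case True
      then show ?thesis using xs ys by (simp add: sum_list_triv)
    next
      case False
      with i tr[of i] mat_trace_similar[OF similar_mat_wit_pow[OF sim, of i]]
      show ?thesis by (simp add: mat_trace_list_diag_mat_pow)
    qed
  qed simp
  then obtain S where S: "S \<in> orthogonal_mats n" "S * list_diag_mat ys * transpose_mat S = X"
    using orthogonal_reorder[OF Q xs(1)] XQ by blast
  then obtain T where "T \<in> special_orthogonal n" "T * list_diag_mat ys * transpose_mat T = X"
    using orthogonal_to_special[OF S(1) n ys(1)] by blast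
  then show "X \<in> ?R" by blast
next
  fix X assume "X \<in> ?R"
  then obtain Q where Qs: "Q \<in> special_orthogonal n" and XQ: "X = Q * list_diag_mat ys * transpose_mat Q"
    by blast
  then have Q: "Q \<in> orthogonal_mats n" by (simp add: special_orthogonal_def orthogonal_mats_def)
  note q = orthogonal_matsD[OF Q]
  have D: "list_diag_mat ys \<in> carrier_mat n n" using ys by (simp add: list_diag_mat_carrier)
  have "transpose_mat X = Q * transpose_mat (list_diag_mat ys) * transpose_mat Q"
    unfolding XQ using q(1,2) D
    by (simp add: transpose_mult[of _ n n _ n] assoc_mult_mat[of _ n n _ n _ n])
  then have "X \<in> symmetric_mats n"
    using q(1,2) D by (simp add: symmetric_mats_def XQ list_diag_mat_def)
  moreover have "annihilator_prod n X cs = 0\<^sub>m n n"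
    using annihilator_prod_conj[OF Q D, of cs] annihilator_prod_list_diag_mat_eq_0[OF ys(2,1)] q(1,2)
    by (simp add: XQ)
  moreover have "mat_trace (X ^\<^sub>m i) = sum_list (map (\<lambda>y. y ^ i) ys)" for i
    using mat_trace_similar[OF similar_mat_wit_pow[OF orthogonal_conj_similar[OF Q D], of i]]
    by (simp add: XQ mat_trace_list_diag_mat_pow)
  ultimately show "X \<in> ?L" by blast
qed

theorem corollary4p2:
  fixes p n :: nat and k m :: "nat \<Rightarrow> nat" and a :: "nat \<Rightarrow> real"
  assumes "p \<ge> 1"
    and "k 0 = 0"
    and "\<And>i. i \<le> p \<Longrightarrow> k i < k (i + 1)"
    and "k (p + 1) = n"
    and "\<And>i. i \<le> p \<Longrightarrow> m (i + 1) = k (i + 1) - k i"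
    and "inj_on a {1..p + 1}"
  shows "{X \<in> symmetric_mats n.
            mat_prod_list n (map (\<lambda>j. X - a (j + 1) \<cdot>\<^sub>m 1\<^sub>m n) [0..<p + 1]) = 0\<^sub>m n n \<and>
            (\<forall>i\<in>{1..p}. mat_trace (X ^\<^sub>m i) = (\<Sum>j=0..p. real (m (j + 1)) * a (j + 1) ^ i))}
       = {Q * diag_block_mat (map (\<lambda>j. a j \<cdot>\<^sub>m 1\<^sub>m (m j)) [1..<p + 2]) * transpose_mat Q
            | Q. Q \<in> special_orthogonal n}"
proof -
  define cs where "cs = map (\<lambda>j. a (j + 1)) [0..<p + 1]"
  define ys where "ys = concat (map (\<lambda>j. replicate (m j) (a j)) [1..<p + 2])"
  have shift: "[1..<p + 2] = map Suc [0..<p + 1]" by (simp add: map_Suc_upt)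
  have n: "n > 0" using assms(3)[of p] assms(4) by simp
  have "set cs = a ` (Suc ` set [0..<p + 1])"
    by (simp only: cs_def set_map image_image Suc_eq_plus1)
  also have "Suc ` set [0..<p + 1] = {1..p + 1}"
    by (simp only: set_upt image_Suc_atLeastLessThan) auto
  finally have set_cs: "set cs = a ` {1..p + 1}" .
  then have card: "card (set cs) = p + 1"
    using card_image[OF assms(6)] set_cs by simp
  have sub: "set ys \<subseteq> set cs"
    unfolding set_cs by (auto simp: ys_def)
  have sum_ys: "sum_list (map f ys) = (\<Sum>j=0..p. real (m (j + 1)) * f (a (j + 1)))" for f :: "real \<Rightarrow> real"
  proof -
    have gen: "sum_list (map f (concat (map (\<lambda>j. replicate (m j) (a j)) js))) = (\<Sum>j\<leftarrow>js. real (m j) * f (a j))"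
      for js
      by (induction js) (simp_all add: sum_list_replicate)
    have "sum_list (map f ys) = (\<Sum>j\<leftarrow>[0..<p + 1]. real (m (j + 1)) * f (a (j + 1)))"
      unfolding ys_def gen unfolding shift map_map by (simp add: o_def del: upt_Suc)
    also have "\<dots> = (\<Sum>j\<in>set [0..<p + 1]. real (m (j + 1)) * f (a (j + 1)))"
      by (rule sum_list_distinct_conv_sum_set) simp
    also have "set [0..<p + 1] = {0..p}" by auto
    finally show ?thesis .
  qed
  have "length ys = (\<Sum>j<p + 1. m (j + 1))"
    unfolding ys_def shift
    by (simp add: length_concat o_def interv_sum_list_conv_sum_set_nat atLeast0LessThan del: upt_Suc)
  also have "\<dots> = (\<Sum>j<p + 1. k (j + 1) - k j)"
    using assms(5) by (intro sum.cong) auto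
  (* Truncated subtraction is exact here because k is increasing, so the sum telescopes. *)
  also have "\<dots> = n"
  proof -
    have "(\<Sum>j<q. k (j + 1) - k j) = k q" if "q \<le> p + 1" for q
      using that
    proof (induction q)
      case (Suc q)
      then show ?case using assms(3)[of q] by simp
    qed (simp add: assms(2))
    from this[of "p + 1"] show ?thesis using assms(4) by (simp del: sum.lessThan_Suc)
  qed
  finally have len: "length ys = n" .
  have range: "{1..<card (set cs)} = {1..p}" using card by auto
  have ann: "mat_prod_list n (map (\<lambda>j. X - a (j + 1) \<cdot>\<^sub>m 1\<^sub>m n) [0..<p + 1]) = annihilator_prod n X cs" for X
    by (simp add: annihilator_prod_def cs_def o_def del: upt_Suc)
  show ?thesis
    using annihilated_isospectral_eq_special_orthogonal_orbit[OF n len sub]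
    unfolding range sum_ys ann diag_block_mat_scalar_blocks ys_def[symmetric] .
qed

end
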